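(* Let $R$ be a commutative ring, let $(a,b,c,d)\in Um(R^4)$ and let $A=\begin{bmatrix} a & b\\ c & d\end{bmatrix}$. Consider the following ten statements: (S1) $A$ is equivalent to the diagonal matrix $\mathrm{Diag}(1,\det(A))$. (S2) $A$ is simply extendable. (S3) There exists $(e,f)\in R^2$ such that $(ae+cf,be+df)\in Um(R^2)$. (S4) There exists $(x,y,z,w)\in R^4$ such that $ax+by+cz+dw=1$ and the matrix $\begin{bmatrix} x & y\\ z & w\end{bmatrix}$ is non-full. (S5) There exists $(x,y,z,w)\in R^4$ such that $ax+by+cz+dw=1$ and $xw-yz=0$. (S6) There exists $B\in Um(\mathbb{M}_2(R))$ such that $(ad-bc)B+A\in Um(\mathbb{M}_2(R))$ and both $B$ and $(ad-bc)B+A$ have zero determinant. (S7) There exists $C\in Um(\mathbb{M}_2(R))$ congruent to $A$ modulo $R(ad-bc)$ and with $\det(C)=0$. (S8) There exists $B\in\mathbb{M}_2(R)$ such that both $B$ and $(ad-bc)B+A$ have zero determinant. (S9) There exists $(x,y,z,w)\in R^4$ such that $ax+by+cz+dw-(ad-bc)(xw-yz)=1$. (S10) There exists $C\in\mathbb{M}_2(R)$ congruent to $A$ modulo $R(ad-bc)$ and with $\det(C)=0$. Then the following implications hold: $$(S1)\Leftrightarrow(S2)\Leftrightarrow(S3)\Leftrightarrow(S4)\Rightarrow(S5)\Leftrightarrow(S6)\Leftrightarrow(S7)\Leftrightarrow(S8)\Rightarrow(S9)\Rightarrow(S10).$$ Moreover, if $R$ is reduced, then $(S9)\Leftrightarr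ow(S10)$.
   Context: Rings are commutative with identity. $Um(R^n)$ is the set of $n$-tuples generating the unit ideal of $R$; $Um(\mathbb{M}_2(R))$ is the set of $2\times 2$ matrices whose entries generate the unit ideal. $A,B\in\mathbb{M}_2(R)$ are equivalent if $A=MBN$ with $M,N\in GL_2(R)$; they are congruent modulo an ideal $I$ if all entries of $A-B$ lie in $I$. $A\in\mathbb{M}_2(R)$ is simply extendable if there is $A^+\in SL_3(R)$ whose upper-left $2\times2$ block is $A$ and whose $(3,3)$ entry is $0$. A $2\times 2$ matrix is non-full if it is the product of a $2\times1$ matrix and a $1\times2$ matrix with entries in $R$. *)

theory Defs
  imports "HOL-Analysis.Analysis"
begin

text \<open>
  The ideals of a commutative ring are its submodules as a module over itself, so the ideal
  generated by a set is its span with respect to the ring multiplication.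
\<close>

lemma module_ring_mult: "module ((*) :: 'a::comm_ring_1 \<Rightarrow> 'a \<Rightarrow> 'a)"
  by unfold_locales (simp_all add: algebra_simps)

definition ideal_generated :: "'a::comm_ring_1 set \<Rightarrow> 'a set"
  where "ideal_generated S = module.span (*) S"

definition Um :: "('a::comm_ring_1 ^ 'n) set"
  where "Um = {v. ideal_generated {v $ i | i. True} = UNIV}"

definition Um_mat :: "('a::comm_ring_1 ^ 2 ^ 2) set"
  where "Um_mat = {A. ideal_generated {A $ i $ j | i j. True} = UNIV}"

definition mat2 :: "'a::zero \<Rightarrow> 'a \<Rightarrow> 'a \<Rightarrow> 'a \<Rightarrow> 'a ^ 2 ^ 2"
  where "mat2 a b c d = vector [vector [a, b], vector [c, d]]"

definition mat_equivalent :: "'a::comm_ring_1 ^ 2 ^ 2 \<Rightarrow> 'a ^ 2 ^ 2 \<Rightarrow> bool"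
  where "mat_equivalent A B \<longleftrightarrow>
    (\<exists>M N :: 'a ^ 2 ^ 2. invertible M \<and> invertible N \<and> A = M ** B ** N)"

definition mat_congruent :: "'a::comm_ring_1 set \<Rightarrow> 'a ^ 2 ^ 2 \<Rightarrow> 'a ^ 2 ^ 2 \<Rightarrow> bool"
  where "mat_congruent I A B \<longleftrightarrow> (\<forall>i j. (A - B) $ i $ j \<in> I)"

text \<open>
  In the index type \<open>2\<close> the numeral \<open>2\<close> equals \<open>0\<close>, and likewise \<open>3 = 0\<close> in the index type
  \<open>3\<close>.  So there is no uniform cast between the two, and the four entries of the upper-left
  block are written out one by one.
\<close>

definition simply_extendable :: "'a::comm_ring_1 ^ 2 ^ 2 \<Rightarrow> bool"
  where "simply_extendable A \<longleftrightarrow>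
    (\<exists>P :: 'a ^ 3 ^ 3. det P = 1 \<and>
       P $ 1 $ 1 = A $ 1 $ 1 \<and> P $ 1 $ 2 = A $ 1 $ 2 \<and>
       P $ 2 $ 1 = A $ 2 $ 1 \<and> P $ 2 $ 2 = A $ 2 $ 2 \<and>
       P $ 3 $ 3 = 0)"

text \<open>\<open>'a ^ n ^ m\<close> is the type of matrices with \<open>m\<close> rows and \<open>n\<close> columns.\<close>

definition non_full :: "'a::comm_ring_1 ^ 2 ^ 2 \<Rightarrow> bool"
  where "non_full A \<longleftrightarrow> (\<exists>(U :: 'a ^ 1 ^ 2) (V :: 'a ^ 2 ^ 1). A = U ** V)"

definition nilpotent :: "'a::comm_ring_1 \<Rightarrow> bool"
  where "nilpotent r \<longleftrightarrow> (\<exists>n::nat. r ^ n = 0)"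

definition reduced_ring :: "'a::comm_ring_1 itself \<Rightarrow> bool"
  where "reduced_ring _ \<longleftrightarrow> (\<forall>r::'a. nilpotent r \<longrightarrow> r = 0)"

end

theory Submission
  imports Defs
begin

text \<open>
  (S1) to (S4) all say that \<open>(e, f) A (u, v)\<^sup>T = 1\<close> is solvable.  The others rest on
  \<open>det (A + DB) = D (1 + tr (A adj B) + D det B)\<close> for \<open>D = det A\<close>: a solution
  \<open>X = [[x, z], [y, w]]\<close> of (S5) or (S9), where \<open>ax + by + cz + dw = tr (AX)\<close>, yields
  \<open>B = - adj X\<close> with \<open>det (A + DB) = 0\<close>.  Conversely \<open>det (A + DB) = 0\<close> only gives \<open>D g = 0\<close> for
  \<open>g = 1 + tr (A adj B) + D det B\<close>, and adding \<open>g Q\<close> to \<open>- adj B\<close>, with a suitable \<open>Q\<close> of trace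
  pairing 1, absorbs this defect.
\<close>

section \<open>Ideals and unimodular tuples\<close>

lemma ideal_generated_eq_UNIV_iff:
  "ideal_generated S = UNIV \<longleftrightarrow> 1 \<in> ideal_generated (S :: 'a::comm_ring_1 set)"
proof
  assume "1 \<in> ideal_generated S"
  then have "x * 1 \<in> ideal_generated S" for x
    unfolding ideal_generated_def by (rule module.span_scale[OF module_ring_mult])
  then show "ideal_generated S = UNIV"
    by auto
qed simp

lemma mem_ideal_generated_insert:
  "x \<in> ideal_generated (insert a S) \<longleftrightarrow> (\<exists>k. x - k * a \<in> ideal_generated S)"
  unfolding ideal_generated_def by (rule module.span_breakdown_eq[OF module_ring_mult])

lemma ideal_generated_empty: "ideal_generated {} = {0}"
  unfolding ideal_generated_def by (rule module.span_empty[OF module_ring_mult])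

lemma mem_ideal_generated_singleton:
  "x \<in> ideal_generated {a} \<longleftrightarrow> (\<exists>k. x = a * k)"
  by (simp add: mem_ideal_generated_insert ideal_generated_empty mult.commute)

lemma ideal_generated_pair_eq_UNIV_iff:
  "ideal_generated {a, b} = UNIV \<longleftrightarrow> (\<exists>x y. a * x + b * y = 1)"
  unfolding ideal_generated_eq_UNIV_iff mem_ideal_generated_insert ideal_generated_empty
  by (auto simp: algebra_simps)

lemma ideal_generated_quadruple_eq_UNIV_iff:
  "ideal_generated {a, b, c, d} = UNIV \<longleftrightarrow> (\<exists>x y z w. a * x + b * y + c * z + d * w = 1)"
proof -
  have "1 - k * a - l * b - m * c - n * d = 0 \<longleftrightarrow> a * k + b * l + c * m + d * n = 1" for k l m n
    by (auto simp: algebra_simps)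
  then show ?thesis
    unfolding ideal_generated_eq_UNIV_iff mem_ideal_generated_insert ideal_generated_empty
    by simp
qed

lemma vector_4:
  "(vector [a, b, c, d] :: 'a::zero ^ 4) $ 1 = a"
  "(vector [a, b, c, d] :: 'a ^ 4) $ 2 = b"
  "(vector [a, b, c, d] :: 'a ^ 4) $ 3 = c"
  "(vector [a, b, c, d] :: 'a ^ 4) $ 4 = d"
  unfolding vector_def by simp_all

lemma ex_2: "(\<exists>i::2. P i) \<longleftrightarrow> P 1 \<or> P 2"
  by (metis exhaust_2)

lemma vector_2_in_Um_iff:
  "(vector [a, b] :: 'a::comm_ring_1 ^ 2) \<in> Um \<longleftrightarrow> (\<exists>x y. a * x + b * y = 1)"
proof -
  have "{(vector [a, b] :: 'a ^ 2) $ i | i. True} = {a, b}"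
    by (auto simp: full_SetCompr_eq UNIV_2)
  then show ?thesis
    by (simp add: Um_def ideal_generated_pair_eq_UNIV_iff)
qed

lemma vector_4_in_Um_iff:
  "(vector [a, b, c, d] :: 'a::comm_ring_1 ^ 4) \<in> Um \<longleftrightarrow>
    (\<exists>x y z w. a * x + b * y + c * z + d * w = 1)"
proof -
  have "{(vector [a, b, c, d] :: 'a ^ 4) $ i | i. True} = {a, b, c, d}"
    by (auto simp: full_SetCompr_eq UNIV_4 vector_4)
  then show ?thesis
    by (simp add: Um_def ideal_generated_quadruple_eq_UNIV_iff)
qed

section \<open>Two-by-two matrices by entries\<close>

lemma mat2_nth [simp]:
  "mat2 a b c d $ 1 $ 1 = a" "mat2 a b c d $ 1 $ 2 = b"
  "mat2 a b c d $ 2 $ 1 = c" "mat2 a b c d $ 2 $ 2 = d"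
  by (simp_all add: mat2_def)

lemma mat2_eta: "A = mat2 (A $ 1 $ 1) (A $ 1 $ 2) (A $ 2 $ 1) (A $ 2 $ 2)"
  by (simp add: vec_eq_iff forall_2)

lemma ex_mat2: "(\<exists>A. P A) \<longleftrightarrow> (\<exists>a b c d. P (mat2 a b c d))"
  by (metis mat2_eta)

lemma mat2_eq_iff:
  "mat2 a b c d = mat2 a' b' c' d' \<longleftrightarrow> a = a' \<and> b = b' \<and> c = c' \<and> d = d'"
  by (auto simp: vec_eq_iff forall_2)

lemma det_mat2: "det (mat2 a b c d) = a * d - b * c"
  by (simp add: det_2)

lemma mat2_mult:
  "mat2 a b c d ** mat2 x y z w =
    mat2 (a * x + b * z) (a * y + b * w) (c * x + d * z) (c * y + d * w)"
  by (simp add: vec_eq_iff forall_2 matrix_matrix_mult_def sum_2)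

lemma mat_1_eq_mat2: "mat 1 = mat2 1 0 0 1"
  by (simp add: vec_eq_iff forall_2 mat_def)

lemma mat2_in_Um_mat_iff:
  "mat2 a b c d \<in> Um_mat \<longleftrightarrow> (\<exists>x y z w. a * x + b * y + c * z + d * w = 1)"
proof -
  have "{mat2 a b c d $ i $ j | i j. True} = {a, b, c, d}"
    by (simp add: set_eq_iff ex_2)
  then show ?thesis
    by (simp add: Um_mat_def ideal_generated_quadruple_eq_UNIV_iff)
qed

lemma mat_congruent_mat2_iff:
  "mat_congruent (ideal_generated {D}) (mat2 p q r s) (mat2 a b c d) \<longleftrightarrow>
    (\<exists>k l m n. mat2 p q r s = mat2 (a + D * k) (b + D * l) (c + D * m) (d + D * n))"
  by (simp add: mat_congruent_def forall_2 mem_ideal_generated_singleton mat2_eq_iff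
      diff_eq_eq add.commute conj_assoc)

lemma map_matrix_mult_add_mat2:
  fixes a b c d p q r s D :: "'a::comm_ring_1"
  shows "map_matrix ((*) D) (mat2 p q r s) + mat2 a b c d =
    mat2 (a + D * p) (b + D * q) (c + D * r) (d + D * s)"
  by (simp add: vec_eq_iff forall_2 add.commute)

section \<open>Non-fullness, simple extension and diagonal reduction\<close>

lemma non_full_mat2_iff:
  "non_full (mat2 x y z w) \<longleftrightarrow>
    (\<exists>e f u v. x = e * u \<and> y = e * v \<and> z = f * u \<and> w = f * v)"
proof
  assume "non_full (mat2 x y z w)"
  then obtain U :: "'a ^ 1 ^ 2" and V :: "'a ^ 2 ^ 1" where "mat2 x y z w = U ** V"
    unfolding non_full_def by blast
  then show "\<exists>e f u v. x = e * u \<and> y = e * v \<and> z = f * u \<and> w = f * v"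
    by (simp add: vec_eq_iff forall_2 matrix_matrix_mult_def sum_1) blast
next
  assume "\<exists>e f u v. x = e * u \<and> y = e * v \<and> z = f * u \<and> w = f * v"
  then obtain e f u v where "x = e * u" "y = e * v" "z = f * u" "w = f * v"
    by blast
  then have "mat2 x y z w =
      (vector [vector [e], vector [f]] :: 'a ^ 1 ^ 2) ** vector [vector [u, v]]"
    by (simp add: vec_eq_iff forall_2 matrix_matrix_mult_def sum_1)
  then show "non_full (mat2 x y z w)"
    unfolding non_full_def by blast
qed

text \<open>A 3 by 3 determinant with corner 0 is minus border row times \<open>adj A\<close> times
  border column. A swap and a sign in each border vector turn this into
  \<open>(e, f) A (u, v)^T\<close>.\<close>

lemma simply_extendable_mat2_iff:
  "simply_extendable (mat2 a b c d) \<longleftrightarrow>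
    (\<exists>e f u v. (a * e + c * f) * u + (b * e + d * f) * v = 1)"
proof
  assume "simply_extendable (mat2 a b c d)"
  then obtain P :: "'a ^ 3 ^ 3" where "det P = 1" and
    "P $ 1 $ 1 = a" "P $ 1 $ 2 = b" "P $ 2 $ 1 = c" "P $ 2 $ 2 = d" "P $ 3 $ 3 = 0"
    unfolding simply_extendable_def by auto
  then have "(a * - P $ 2 $ 3 + c * P $ 1 $ 3) * P $ 3 $ 2
      + (b * - P $ 2 $ 3 + d * P $ 1 $ 3) * - P $ 3 $ 1 = 1"
    by (simp add: det_3 algebra_simps)
  then show "\<exists>e f u v. (a * e + c * f) * u + (b * e + d * f) * v = 1"
    by blast
next
  assume "\<exists>e f u v. (a * e + c * f) * u + (b * e + d * f) * v = 1"
  then obtain e f u v where "(a * e + c * f) * u + (b * e + d * f) * v = 1"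
    by blast
  then have "det (vector [vector [a, b, f], vector [c, d, - e], vector [- v, u, 0]] :: 'a ^ 3 ^ 3) = 1"
    by (simp add: det_3 algebra_simps)
  then show "simply_extendable (mat2 a b c d)"
    unfolding simply_extendable_def
    by (intro exI[of _ "vector [vector [a, b, f], vector [c, d, - e], vector [- v, u, 0]]"]) simp
qed

lemma mat_equivalent_Diag_1_det_iff:
  "mat_equivalent (mat2 a b c d) (mat2 1 0 0 (a * d - b * c)) \<longleftrightarrow>
    (\<exists>e f u v. (a * e + c * f) * u + (b * e + d * f) * v = 1)"
proof
  let ?D = "a * d - b * c"
  assume "mat_equivalent (mat2 a b c d) (mat2 1 0 0 ?D)"
  then obtain M N M' N' where
    A: "mat2 a b c d = M ** mat2 1 0 0 ?D ** N" and
    "M' ** M = mat 1" "N ** N' = mat 1"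
    unfolding mat_equivalent_def invertible_def by blast
  then have "M' ** mat2 a b c d ** N' = mat2 1 0 0 ?D"
    by (metis matrix_mul_assoc matrix_mul_lid matrix_mul_rid)
  \<comment> \<open>The first row of \<open>M'\<close> and the first column of \<open>N'\<close>
    serve as \<open>(e, f)\<close> and \<open>(u, v)\<close>.\<close>
  then have "(M' ** mat2 a b c d ** N') $ 1 $ 1 = 1"
    by simp
  then have "(a * M' $ 1 $ 1 + c * M' $ 1 $ 2) * N' $ 1 $ 1
      + (b * M' $ 1 $ 1 + d * M' $ 1 $ 2) * N' $ 2 $ 1 = 1"
    by (simp add: matrix_matrix_mult_def sum_2 algebra_simps)
  then show "\<exists>e f u v. (a * e + c * f) * u + (b * e + d * f) * v = 1"
    by blast
next
  let ?D = "a * d - b * c"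
  assume "\<exists>e f u v. (a * e + c * f) * u + (b * e + d * f) * v = 1"
  then obtain e f u v where 1: "(a * e + c * f) * u + (b * e + d * f) * v = 1"
    by blast
  \<comment> \<open>\<open>M'\<close> extends the row \<open>(e, f)\<close> and \<open>N'\<close>
    the column \<open>(u, v)\<close> so that both determinants equal
    \<open>(e, f) A (u, v)^T = 1\<close>; \<open>M\<close> and \<open>N\<close> are their
    adjugates.\<close>
  define M where "M = mat2 (a * u + b * v) (- f) (c * u + d * v) e"
  define M' where "M' = mat2 e f (- (c * u + d * v)) (a * u + b * v)"
  define N where "N = mat2 (a * e + c * f) (b * e + d * f) (- v) u"
  define N' where "N' = mat2 u (- (b * e + d * f)) v (a * e + c * f)"
  have "M ** M' = mat 1" "M' ** M = mat 1" "N ** N' = mat 1" "N' ** N = mat 1"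
    unfolding M_def M'_def N_def N'_def mat2_mult mat_1_eq_mat2 mat2_eq_iff
    using 1 by (simp_all add: algebra_simps)
  then have "invertible M" "invertible N"
    unfolding invertible_def by blast+
  moreover have "mat2 a b c d = M ** mat2 1 0 0 ?D ** N"
  proof -
    \<comment> \<open>\<open>M Diag(1, D) N = t A\<close> is a polynomial identity, so scaling
      \<open>A\<close> by \<open>?t\<close> leaves only ring normalisation.\<close>
    let ?t = "(a * e + c * f) * u + (b * e + d * f) * v"
    have "mat2 a b c d = mat2 (a * ?t) (b * ?t) (c * ?t) (d * ?t)"
      using 1 by simp
    also have "\<dots> = M ** mat2 1 0 0 ?D ** N"
      unfolding M_def N_def mat2_mult mat2_eq_iff by (simp add: algebra_simps)
    finally show ?thesis .
  qed
  ultimately show "mat_equivalent (mat2 a b c d) (mat2 1 0 0 ?D)"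
    unfolding mat_equivalent_def by blast
qed

section \<open>Determinant and unimodularity of \<open>A + DB\<close>\<close>

lemma det_add_det_mult:
  fixes a b c d p q r s D :: "'a::comm_ring_1"
  assumes "D = a * d - b * c"
  shows "(a + D * p) * (d + D * s) - (b + D * q) * (c + D * r) =
    D * (1 + (a * s - b * r - c * q + d * p) + D * (p * s - q * r))"
proof -
  have "(a + D * p) * (d + D * s) - (b + D * q) * (c + D * r) =
    (a * d - b * c) + D * ((a * s - b * r - c * q + d * p) + D * (p * s - q * r))"
    by (simp add: algebra_simps)
  then show ?thesis
    using assms by (simp add: algebra_simps)
qed

text \<open>
  Modulo the entries of \<open>C = A + det(A) B\<close> one has \<open>A = - det(A) B\<close>, hence
  \<open>det A = det(A)\<^sup>2 det B = 0\<close> and \<open>A = 0\<close>.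
\<close>

lemma unimodular_add_det_mult:
  fixes a b c d p q r s :: "'a::comm_ring_1"
  assumes D: "D = a * d - b * c" and B: "p * s - q * r = 0"
    and A: "a * x + b * y + c * z + d * w = 1"
  shows "\<exists>k l m n. (a + D * p) * k + (b + D * q) * l + (c + D * r) * m + (d + D * s) * n = 1"
proof -
  \<comment> \<open>The tuple \<open>x, y, z, w\<close> pairs with \<open>C = A + DB\<close> to
    \<open>1 + D t\<close>. The corrections remove \<open>D t\<close>: row 1 of \<open>C\<close>
    against row 2 of \<open>A\<close>, and row 2 of \<open>C\<close> against row 1 of
    \<open>DB\<close>, give \<open>- t D\<close> up to a multiple of \<open>det B\<close>.\<close>
  define t where "t = p * x + q * y + r * z + s * w"
  have "(a + D * p) * (x - t * d) + (b + D * q) * (y + t * c)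
      + (c + D * r) * (z - t * (D * q)) + (d + D * s) * (w + t * (D * p))
    = (a * x + b * y + c * z + d * w) + D * t - t * (a * d - b * c) + t * (D * D) * (p * s - q * r)"
    unfolding t_def by (simp add: algebra_simps)
  also have "\<dots> = 1"
    using A B D by (simp add: mult.commute)
  finally show ?thesis
    by blast
qed

text \<open>
  With \<open>C = A + DB\<close> and \<open>Q = [[x, z], [y, w]]\<close>, so that \<open>tr (CQ) = 1\<close>, the witness is
  \<open>X = QC (gQ - adj B)\<close>.  It has trace pairing 1 with \<open>A\<close> since \<open>CQC = tr (CQ) C = C\<close> by
  Cayley-Hamilton and \<open>D g = 0\<close>.
\<close>

lemma ex_singular_trace_eq_1:
  fixes a b c d p q r s x y z w D :: "'a::comm_ring_1"
  defines "g \<equiv> 1 + (a * s - b * r - c * q + d * p) + D * (p * s - q * r)"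
  assumes g: "D * g = 0"
    and C: "(a + D * p) * (d + D * s) - (b + D * q) * (c + D * r) = 0"
    and Q: "(a + D * p) * x + (b + D * q) * y + (c + D * r) * z + (d + D * s) * w = 1"
  shows "\<exists>x y z w. a * x + b * y + c * z + d * w = 1 \<and> x * w - y * z = 0"
proof -
  define C1 C2 C3 C4 where C_def:
    "C1 = a + D * p" "C2 = b + D * q" "C3 = c + D * r" "C4 = d + D * s"
  then have A: "a = C1 - D * p" "b = C2 - D * q" "c = C3 - D * r" "d = C4 - D * s"
    by simp_all
  have dC: "C1 * C4 = C2 * C3" and tC: "C1 * x + C2 * y + C3 * z + C4 * w = 1"
    using C Q by (simp_all add: C_def)
  \<comment> \<open>\<open>F = QC\<close>, and then \<open>Y = gQ - adj B\<close>, so that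
    \<open>X = FY\<close>.\<close>
  define F1 F2 F3 F4 where F_def:
    "F1 = x * C1 + z * C3" "F2 = x * C2 + z * C4"
    "F3 = y * C1 + w * C3" "F4 = y * C2 + w * C4"
  define Y1 Y2 Y3 Y4 where Y_def:
    "Y1 = g * x - s" "Y2 = g * z + q" "Y3 = g * y + r" "Y4 = g * w - p"
  define X where "X = mat2 F1 F2 F3 F4 ** mat2 Y1 Y2 Y3 Y4"
  \<comment> \<open>Entrywise, \<open>CQC - tr (CQ) C = - det(C) adj Q\<close>.\<close>
  have "C1 * F1 + C2 * F3 - C1 * (C1 * x + C2 * y + C3 * z + C4 * w) = - w * (C1 * C4 - C2 * C3)"
    "C1 * F2 + C2 * F4 - C2 * (C1 * x + C2 * y + C3 * z + C4 * w) = z * (C1 * C4 - C2 * C3)"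
    "C3 * F1 + C4 * F3 - C3 * (C1 * x + C2 * y + C3 * z + C4 * w) = y * (C1 * C4 - C2 * C3)"
    "C3 * F2 + C4 * F4 - C4 * (C1 * x + C2 * y + C3 * z + C4 * w) = - x * (C1 * C4 - C2 * C3)"
    unfolding F_def by (simp_all add: algebra_simps)
  then have CF: "C1 * F1 + C2 * F3 = C1" "C1 * F2 + C2 * F4 = C2"
    "C3 * F1 + C4 * F3 = C3" "C3 * F2 + C4 * F4 = C4"
    unfolding tC dC by simp_all
  have tF: "F1 + F4 = 1"
    using tC by (simp add: F_def algebra_simps)
  \<comment> \<open>\<open>e = tr (BFQ)\<close> collects the terms of
    \<open>tr ((C - DB) F Y)\<close> killed by \<open>D g = 0\<close>; the \<open>adj B\<close> part
    of \<open>Y\<close> contributes \<open>D det(B) tr F\<close>.\<close>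
  define e where "e = (p * F1 + q * F3) * x + (p * F2 + q * F4) * y
    + (r * F1 + s * F3) * z + (r * F2 + s * F4) * w"
  have "a * X $ 1 $ 1 + b * X $ 2 $ 1 + c * X $ 1 $ 2 + d * X $ 2 $ 2
    = ((C1 * F1 + C2 * F3) * Y1 + (C1 * F2 + C2 * F4) * Y3
      + (C3 * F1 + C4 * F3) * Y2 + (C3 * F2 + C4 * F4) * Y4)
      - D * g * e + D * (p * s - q * r) * (F1 + F4)"
    unfolding A X_def e_def mat2_mult mat2_nth Y_def by (simp add: algebra_simps)
  also have "\<dots> = g * (C1 * x + C2 * y + C3 * z + C4 * w)
      - (C1 * s - C2 * r - C3 * q + C4 * p) + D * (p * s - q * r)"
    unfolding CF tF g Y_def by (simp add: algebra_simps)
  \<comment> \<open>Replacing \<open>A\<close> by \<open>C - DB\<close> in \<open>g\<close> changes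
    \<open>tr (A adj B)\<close> by \<open>- 2 D det B\<close>, which cancels the two terms
    \<open>D det B\<close>.\<close>
  also have "\<dots> = 1"
    unfolding tC g_def A by (simp add: algebra_simps)
  finally have "a * X $ 1 $ 1 + b * X $ 2 $ 1 + c * X $ 1 $ 2 + d * X $ 2 $ 2 = 1" .
  moreover have "F1 * F4 - F2 * F3 = (x * w - y * z) * (C1 * C4 - C2 * C3)"
    unfolding F_def by (simp add: algebra_simps)
  then have "det X = 0"
    unfolding X_def det_mul det_mat2 dC by simp
  then have "X $ 1 $ 1 * X $ 2 $ 2 - X $ 2 $ 1 * X $ 1 $ 2 = 0"
    by (simp add: det_2 mult.commute)
  ultimately show ?thesis
    by blast
qed

section \<open>The chain of implications\<close>

theorem theorem3p2:
  fixes a b c d :: "'a::comm_ring_1"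
  assumes "(vector [a, b, c, d] :: 'a ^ 4) \<in> Um"
  shows
    "let A = mat2 a b c d;
         S1 = mat_equivalent A (mat2 1 0 0 (det A));
         S2 = simply_extendable A;
         S3 = (\<exists>e f. (vector [a * e + c * f, b * e + d * f] :: 'a ^ 2) \<in> Um);
         S4 = (\<exists>x y z w. a * x + b * y + c * z + d * w = 1 \<and> non_full (mat2 x y z w));
         S5 = (\<exists>x y z w. a * x + b * y + c * z + d * w = 1 \<and> x * w - y * z = 0);
         S6 = (\<exists>B \<in> Um_mat. map_matrix ((*) (a * d - b * c)) B + A \<in> Um_mat \<and>
                 det B = 0 \<and> det (map_matrix ((*) (a * d - b * c)) B + A) = 0);
         S7 = (\<exists>C \<in> Um_mat. mat_congruent (ideal_generated {a * d - b * c}) C A \<and> det C = 0);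
         S8 = (\<exists>B :: 'a ^ 2 ^ 2. det B = 0 \<and>
                 det (map_matrix ((*) (a * d - b * c)) B + A) = 0);
         S9 = (\<exists>x y z w. a * x + b * y + c * z + d * w
                 - (a * d - b * c) * (x * w - y * z) = 1);
         S10 = (\<exists>C :: 'a ^ 2 ^ 2. mat_congruent (ideal_generated {a * d - b * c}) C A \<and>
                 det C = 0)
     in (S1 \<longleftrightarrow> S2) \<and> (S2 \<longleftrightarrow> S3) \<and> (S3 \<longleftrightarrow> S4) \<and> (S4 \<longrightarrow> S5) \<and>
        (S5 \<longleftrightarrow> S6) \<and> (S6 \<longleftrightarrow> S7) \<and> (S7 \<longleftrightarrow> S8) \<and>
        (S8 \<longrightarrow> S9) \<and> (S9 \<longrightarrow> S10) \<and>
        (reduced_ring TYPE('a) \<longrightarrow> (S9 \<longleftrightarrow> S10))"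
proof -
  define D where "D = a * d - b * c"
  have unimodular: "\<exists>x y z w. a * x + b * y + c * z + d * w = 1"
    using assms by (simp add: vector_4_in_Um_iff)

  \<comment> \<open>The conditions are restated by entries, with \<open>B = [[p, q], [r, s]]\<close>
    and \<open>C = A + DB\<close>; (S1), (S2) and (S4) all reduce to \<open>S3\<close>.\<close>
  define S3 where "S3 \<longleftrightarrow> (\<exists>e f u v. (a * e + c * f) * u + (b * e + d * f) * v = 1)"
  define S5 where "S5 \<longleftrightarrow> (\<exists>x y z w. a * x + b * y + c * z + d * w = 1 \<and> x * w - y * z = 0)"
  define S6 where "S6 \<longleftrightarrow> (\<exists>p q r s. mat2 p q r s \<in> Um_mat \<and>
    mat2 (a + D * p) (b + D * q) (c + D * r) (d + D * s) \<in> Um_mat \<and>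
    p * s - q * r = 0 \<and> (a + D * p) * (d + D * s) - (b + D * q) * (c + D * r) = 0)"
  define S7 where "S7 \<longleftrightarrow> (\<exists>p q r s.
    mat2 (a + D * p) (b + D * q) (c + D * r) (d + D * s) \<in> Um_mat \<and>
    (a + D * p) * (d + D * s) - (b + D * q) * (c + D * r) = 0)"
  define S8 where "S8 \<longleftrightarrow> (\<exists>p q r s. p * s - q * r = 0 \<and>
    (a + D * p) * (d + D * s) - (b + D * q) * (c + D * r) = 0)"
  define S9 where "S9 \<longleftrightarrow> (\<exists>x y z w. a * x + b * y + c * z + d * w - D * (x * w - y * z) = 1)"
  define S10 where "S10 \<longleftrightarrow> (\<exists>p q r s. (a + D * p) * (d + D * s) - (b + D * q) * (c + D * r) = 0)"

  have S1_iff: "mat_equivalent (mat2 a b c d) (mat2 1 0 0 (det (mat2 a b c d))) \<longleftrightarrow> S3"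
    unfolding det_mat2 S3_def by (rule mat_equivalent_Diag_1_det_iff)
  have S2_iff: "simply_extendable (mat2 a b c d) \<longleftrightarrow> S3"
    unfolding S3_def by (rule simply_extendable_mat2_iff)
  have S3_iff: "(\<exists>e f. (vector [a * e + c * f, b * e + d * f] :: 'a ^ 2) \<in> Um) \<longleftrightarrow> S3"
    by (simp add: S3_def vector_2_in_Um_iff)
  have "a * (e * u) + b * (e * v) + c * (f * u) + d * (f * v) =
      (a * e + c * f) * u + (b * e + d * f) * v" for e f u v
    by (simp add: algebra_simps)
  then have S4_iff: "(\<exists>x y z w. a * x + b * y + c * z + d * w = 1 \<and>
      non_full (mat2 x y z w)) \<longleftrightarrow> S3"
    unfolding S3_def non_full_mat2_iff by metis
  have S6_iff: "(\<exists>B \<in> Um_mat. map_matrix ((*) D) B + mat2 a b c d \<in> Um_mat \<and>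
      det B = 0 \<and> det (map_matrix ((*) D) B + mat2 a b c d) = 0) \<longleftrightarrow> S6"
    unfolding S6_def Bex_def ex_mat2 map_matrix_mult_add_mat2 det_mat2 ..
  have S7_iff: "(\<exists>C \<in> Um_mat. mat_congruent (ideal_generated {D}) C (mat2 a b c d) \<and>
      det C = 0) \<longleftrightarrow> S7"
    unfolding S7_def Bex_def ex_mat2 mat_congruent_mat2_iff by (metis det_mat2)
  have S8_iff: "(\<exists>B. det B = 0 \<and> det (map_matrix ((*) D) B + mat2 a b c d) = 0) \<longleftrightarrow> S8"
    unfolding S8_def ex_mat2 map_matrix_mult_add_mat2 det_mat2 ..
  have S10_iff: "(\<exists>C. mat_congruent (ideal_generated {D}) C (mat2 a b c d) \<and> det C = 0) \<longleftrightarrow> S10"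
    unfolding S10_def ex_mat2 mat_congruent_mat2_iff by (metis det_mat2)

  have "S3 \<Longrightarrow> S5"
    unfolding S4_iff[symmetric] S5_def non_full_mat2_iff by fastforce
  \<comment> \<open>The equivalences come from the cycle \<open>S5\<close>, \<open>S6\<close>,
    \<open>S8\<close>, \<open>S7\<close>, \<open>S5\<close>.\<close>
  moreover have "S5 \<Longrightarrow> S6"
  proof -
    assume S5
    then obtain x y z w where A: "a * x + b * y + c * z + d * w = 1" and "x * w - y * z = 0"
      unfolding S5_def by blast
    then have B: "- w * - x - z * y = 0"
      by (simp add: mult.commute)
    \<comment> \<open>\<open>B = - adj X\<close> has the entries of \<open>X\<close> up to order and
      sign, so the entries of \<open>A\<close> witness its unimodularity.\<close>
    have "- w * - d + z * c + y * b + - x * - a = 1"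
      using A by (simp add: algebra_simps)
    then have "mat2 (- w) z y (- x) \<in> Um_mat"
      unfolding mat2_in_Um_mat_iff by blast
    moreover have "mat2 (a + D * - w) (b + D * z) (c + D * y) (d + D * - x) \<in> Um_mat"
      unfolding mat2_in_Um_mat_iff by (rule unimodular_add_det_mult[OF D_def B A])
    moreover have "1 + (a * - x - b * y - c * z + d * - w) = 0"
      unfolding A[symmetric] by simp
    then have "(a + D * - w) * (d + D * - x) - (b + D * z) * (c + D * y) = 0"
      unfolding det_add_det_mult[OF D_def] B by simp
    ultimately show S6
      unfolding S6_def using B by blast
  qed
  moreover have "S6 \<Longrightarrow> S8"
    unfolding S6_def S8_def by blast
  moreover have "S8 \<Longrightarrow> S7"
    unfolding S7_def S8_def mat2_in_Um_mat_iff
    using unimodular unimodular_add_det_mult[OF D_def] by metis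
  \<comment> \<open>\<open>det C = 0\<close> supplies \<open>D g = 0\<close>, and unimodularity of
    \<open>C\<close> supplies \<open>Q\<close>.\<close>
  moreover have "S7 \<Longrightarrow> S5"
    unfolding S7_def S5_def mat2_in_Um_mat_iff
    using ex_singular_trace_eq_1 det_add_det_mult[OF D_def] by metis
  moreover have "S5 \<Longrightarrow> S9"
    unfolding S5_def S9_def by (metis diff_zero mult_zero_right)
  moreover have "S9 \<Longrightarrow> S10"
  proof -
    assume S9
    then obtain x y z w where A: "a * x + b * y + c * z + d * w - D * (x * w - y * z) = 1"
      unfolding S9_def by blast
    \<comment> \<open>Again \<open>B = - adj X\<close>, now with \<open>det B = det X\<close>
      retained.\<close>
    have "1 + (a * - x - b * y - c * z + d * - w) + D * (- w * - x - z * y) = 0"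
      unfolding A[symmetric] by (simp add: algebra_simps)
    then have "(a + D * - w) * (d + D * - x) - (b + D * z) * (c + D * y) = 0"
      unfolding det_add_det_mult[OF D_def] by simp
    then show S10
      unfolding S10_def by blast
  qed
  moreover have "S10 \<Longrightarrow> S9"
  proof -
    assume S10
    then obtain p q r s where "(a + D * p) * (d + D * s) - (b + D * q) * (c + D * r) = 0"
      unfolding S10_def by blast
    define g where "g = 1 + (a * s - b * r - c * q + d * p) + D * (p * s - q * r)"
    have g: "D * g = 0"
      unfolding g_def det_add_det_mult[OF D_def, symmetric] by fact
    obtain x y z w where A: "a * x + b * y + c * z + d * w = 1"
      using unimodular by blast
    \<comment> \<open>The witness is \<open>gQ - adj B\<close>, with \<open>Q\<close> taken from
      unimodularity of \<open>A\<close>. Its determinant is \<open>det B\<close> plus a multiple of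
      \<open>g\<close>, which \<open>D\<close> annihilates.\<close>
    let ?X = "g * x - s" and ?Y = "g * y + r" and ?Z = "g * z + q" and ?W = "g * w - p"
    have "a * ?X + b * ?Y + c * ?Z + d * ?W - D * (?X * ?W - ?Y * ?Z) =
        g * (a * x + b * y + c * z + d * w) - (a * s - b * r - c * q + d * p) - D * (p * s - q * r)
        - D * g * (g * x * w - x * p - s * w - g * y * z - y * q - r * z)"
      by (simp add: algebra_simps)
    also have "\<dots> = 1"
      unfolding A g by (simp add: g_def)
    finally show S9
      unfolding S9_def by blast
  qed
  ultimately show ?thesis
    unfolding Let_def D_def[symmetric] S1_iff S2_iff S3_iff S4_iff S6_iff S7_iff S8_iff S10_iff
      S5_def[symmetric] S9_def[symmetric] by blast
qed

end
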